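(* Let $E_{ij}=E_{ij}^{Re}+iE_{ij}^{Im}\in A^{\mathbb C}$ ($1\le i,j\le n$, $E_{ij}^{Re},E_{ij}^{Im}\in A$) satisfy $$[E_{ij},E_{kl}]=\delta_{jk}E_{il}-\delta_{li}E_{kj},\qquad [E_{ij},\overline{E_{kl}}]=0\qquad\text{for all } i,j,k,l .$$ Let $E$ be the $n\times n$ matrix with entries $E_{ij}$, $\bar E$ the matrix with entries $\overline{E_{ij}}=E_{ij}^{Re}-iE_{ij}^{Im}$, and $E^{\mathbb R}$ the $2n\times2n$ matrix obtained from $E$ by replacing each $E_{ij}$ by the block $\begin{pmatrix}E_{ij}^{Re}&E_{ij}^{Im}\\-E_{ij}^{Im}&E_{ij}^{Re}\end{pmatrix}$. Let $T$ be the $2n\times 2n$ block-diagonal matrix whose $m$-th diagonal $2\times2$ block is $$\begin{pmatrix} n-m+\tfrac14 & \tfrac{i}{4}\\ \tfrac{i}{4} & n-m-\tfrac14\end{pmatrix},\qquad m=1,\dots,n .$$ Then $${\det}^{\mathrm{col}}\big(E^{\mathbb R}+T\big)={\det}^{\mathrm{col}}\big(E+\mathrm{diag}(n-1,n-2,\dots,1,0)\big)\;{\det}^{\mathrm{col}}\big(\bar E+\mathrm{diag}(n-1,n-2,\dots,1,0)\big).$$ The same identity holds with $T$ replaced by its complex conjugate $\bar T$ (i.e. $i$ replaced by $-i$ in $T$).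
   Context: Let $k$ be a field of characteristic different from $2$, $k[i]=k[t]/(t^2+1)$ with $i$ the class of $t$ (a formal imaginary unit; the case $k=\mathbb R$, $k[i]=\mathbb C$ is typical). $A$ is an associative unital (not necessarily commutative) $k$-algebra and $A^{\mathbb C}=A\otimes_k k[i]=A\oplus iA$; for $c=a+ib$ with $a,b\in A$ put $\bar c=a-ib$. The column-determinant of an $N\times N$ matrix $M$ over a not necessarily commutative ring is ${\det}^{\mathrm{col}}M=\sum_{\sigma\in S_N}\mathrm{sgn}(\sigma)\,M_{\sigma(1)1}M_{\sigma(2)2}\cdots M_{\sigma(N)N}$ (factors ordered by column). $[a,b]=ab-ba$. *)

theory Defs
  imports
    "Jordan_Normal_Form.Matrix"
    "HOL-Combinatorics.Permutations"
begin

text \<open>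
  Associative unital algebras over a field. The sort \<open>{ring, monoid_mult}\<close> is used instead of
  \<open>ring_1\<close> because the latter excludes the zero algebra.
\<close>

locale unital_algebra = vector_space scale
  for scale :: "'k::field \<Rightarrow> 'a::{ring,monoid_mult} \<Rightarrow> 'a" +
  assumes scale_mult_left: "scale c x * y = scale c (x * y)"
    and scale_mult_right: "x * scale c y = scale c (x * y)"

text \<open>
  \<open>Adj a b\<close> stands for \<open>a + i b\<close> with a formal central \<open>i\<close> such that \<open>i\<^sup>2 = -1\<close>. For a field \<open>'k\<close>
  of scalars, \<open>'k adjoin_i\<close> is \<open>k[t]/(t\<^sup>2 + 1)\<close>, which need not be a field; for a \<open>k\<close>-algebra \<open>'a\<close>,
  \<open>'a adjoin_i\<close> is its scalar extension to that ring.
\<close>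

datatype 'a adjoin_i = Adj (re_part: 'a) (im_part: 'a)

instantiation adjoin_i :: (ring) ring
begin

definition zero_adjoin_i :: "'a adjoin_i" where
  "0 = Adj 0 0"

definition plus_adjoin_i :: "'a adjoin_i \<Rightarrow> 'a adjoin_i \<Rightarrow> 'a adjoin_i" where
  "x + y = Adj (re_part x + re_part y) (im_part x + im_part y)"

definition uminus_adjoin_i :: "'a adjoin_i \<Rightarrow> 'a adjoin_i" where
  "- x = Adj (- re_part x) (- im_part x)"

definition minus_adjoin_i :: "'a adjoin_i \<Rightarrow> 'a adjoin_i \<Rightarrow> 'a adjoin_i" where
  "x - y = Adj (re_part x - re_part y) (im_part x - im_part y)"

definition times_adjoin_i :: "'a adjoin_i \<Rightarrow> 'a adjoin_i \<Rightarrow> 'a adjoin_i" where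
  "x * y = Adj (re_part x * re_part y - im_part x * im_part y)
               (re_part x * im_part y + im_part x * re_part y)"

instance
  by standard
    (simp_all add: zero_adjoin_i_def plus_adjoin_i_def uminus_adjoin_i_def minus_adjoin_i_def
      times_adjoin_i_def algebra_simps)

end

instantiation adjoin_i :: ("{ring,monoid_mult}") monoid_mult
begin

definition one_adjoin_i :: "'a adjoin_i" where
  "1 = Adj 1 0"

instance
  by standard (simp_all add: one_adjoin_i_def times_adjoin_i_def algebra_simps)

end

definition conj_i :: "'a::ring adjoin_i \<Rightarrow> 'a adjoin_i" where
  "conj_i x = Adj (re_part x) (- im_part x)"

definition of_base :: "'a::ring \<Rightarrow> 'a adjoin_i" where
  "of_base a = Adj a 0"

text \<open>The structure map from \<open>k[i]\<close> to the scalar extension of a \<open>k\<close>-algebra.\<close>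

definition scalar_i ::
    "('k::field \<Rightarrow> 'a::{ring,monoid_mult} \<Rightarrow> 'a) \<Rightarrow> 'k adjoin_i \<Rightarrow> 'a adjoin_i" where
  "scalar_i scale z = Adj (scale (re_part z) 1) (scale (im_part z) 1)"

definition commutator :: "'a::ring \<Rightarrow> 'a \<Rightarrow> 'a" where
  "commutator a b = a * b - b * a"

definition det_col :: "'a::{ring,monoid_mult} mat \<Rightarrow> 'a" where
  "det_col M =
    (if dim_row M = dim_col M then
       (\<Sum>p | p permutes {0..<dim_col M}.
          let x = prod_list (map (\<lambda>j. M $$ (p j, j)) [0..<dim_col M])
          in if evenperm p then x else - x)
     else 0)"

text \<open>
  The \<open>2n \<times> 2n\<close> matrix whose \<open>2 \<times> 2\<close> block in position \<open>(i, j)\<close> is \<open>B i j\<close>. As everywhere for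
  this matrix type, indices start at 0.
\<close>

definition mat_of_blocks2 :: "nat \<Rightarrow> (nat \<Rightarrow> nat \<Rightarrow> 'a mat) \<Rightarrow> 'a mat" where
  "mat_of_blocks2 n B =
    mat (2 * n) (2 * n) (\<lambda>(r, s). B (r div 2) (s div 2) $$ (r mod 2, s mod 2))"

definition realification :: "'a::ring adjoin_i mat \<Rightarrow> 'a mat" where
  "realification E = mat_of_blocks2 (dim_row E) (\<lambda>i j.
     mat_of_rows_list 2
       [[  re_part (E $$ (i, j)), im_part (E $$ (i, j))],
        [- im_part (E $$ (i, j)), re_part (E $$ (i, j))]])"

text \<open>The diagonal block in 0-based position \<open>m\<close> has \<open>n - (m + 1)\<close> where 1-based counting has \<open>n - m\<close>.\<close>

definition T_mat :: "nat \<Rightarrow> 'k::field adjoin_i mat" where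
  "T_mat n = mat_of_blocks2 n (\<lambda>l m.
     if l = m then
       mat_of_rows_list 2
         [[Adj (of_nat (n - Suc m) + 1 / 4) 0, Adj 0 (1 / 4)],
          [Adj 0 (1 / 4), Adj (of_nat (n - Suc m) - 1 / 4) 0]]
     else 0\<^sub>m 2 2)"

definition shift_diag :: "nat \<Rightarrow> 'k::field adjoin_i mat" where
  "shift_diag n = mat_diag n (\<lambda>m. of_base (of_nat (n - Suc m)))"

end

theory Submission
  imports Defs "HOL-Library.Function_Algebras"
begin

text \<open>
  Let \<open>e\<^sub>0, e\<^sub>1, \<dots>\<close> be the generators of an exterior algebra with coefficients in the scalar extension
  of \<open>A\<close>. The product of the columns \<open>\<Sum>r. e\<^sub>r M\<^sub>r\<^sub>s\<close> of a matrix \<open>M\<close>, in the order of \<open>s\<close>, is the top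
  form times the column-determinant of \<open>M\<close> (\<open>prod_list_comb_eq_det_col\<close>), also when the entries do
  not commute with each other. This reduces the theorem to a product of two consecutive columns.

  The realification of \<open>E\<close> splits in the generators \<open>\<theta>\<^sub>l = e\<^sub>2\<^sub>l + i e\<^sub>2\<^sub>l\<^sub>+\<^sub>1\<close> and
  \<open>\<zeta>\<^sub>l = (i e\<^sub>2\<^sub>l + e\<^sub>2\<^sub>l\<^sub>+\<^sub>1) / 2\<close>, for which \<open>e\<^sub>2\<^sub>l e\<^sub>2\<^sub>l\<^sub>+\<^sub>1 = \<theta>\<^sub>l \<zeta>\<^sub>l\<close>. Let \<open>U\<^sub>m\<close> be the column \<open>m\<close> of the
  shifted matrix \<open>E\<close> in the generators \<open>\<theta>\<close>, and \<open>V\<^sub>m\<close> that of the shifted conjugate of \<open>E\<close> in the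
  generators \<open>\<zeta>\<close>. The two columns of block \<open>m\<close> of the left-hand matrix are
  \<open>(U\<^sub>m + \<theta>\<^sub>m / 2) / 2 - i V\<^sub>m\<close> and \<open>V\<^sub>m - i (U\<^sub>m - \<theta>\<^sub>m / 2) / 2\<close>: the terms \<open>\<plusminus> 1/4\<close> and \<open>i/4\<close> of the block
  of \<open>T\<close> only change the shift of \<open>U\<^sub>m\<close>, by one half up in one column and by one half down in the
  other. The commutation relations give exactly
  \<open>(U\<^sub>m + \<theta>\<^sub>m / 2) (U\<^sub>m - \<theta>\<^sub>m / 2) = 0\<close> (\<open>shifted_column_factorisation\<close>), and since \<open>U\<^sub>m\<close> and \<open>V\<^sub>m\<close>
  anticommute the product of the two columns is \<open>(U\<^sub>m - i V\<^sub>m) V\<^sub>m\<close> (\<open>product_of_block_columns\<close>).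

  In the product over all \<open>m\<close> the summands \<open>- i V\<^sub>m\<close> can be dropped, because they lead to terms of
  degree greater than \<open>n\<close> in the \<open>n\<close> generators \<open>\<zeta>\<close> (\<open>prod_list_quadratic_top_degree\<close>). The product
  of all \<open>U\<^sub>m V\<^sub>m\<close> differs from the product of all \<open>U\<^sub>m\<close> times the product of all \<open>V\<^sub>m\<close> by the same sign
  as for \<open>\<theta>\<^sub>m\<close> and \<open>\<zeta>\<^sub>m\<close>, so that it is the top form times the two column-determinants on the right.
  The top form cancels in a faithful model of the exterior algebra (\<open>prod_wedge_cancel\<close>).

  The identity for the conjugate of \<open>T\<close> is the conjugate of the one for \<open>T\<close>, as the two
  column-determinants on the right are conjugate to each other and commute.
\<close>

section \<open>Anticommuting and commuting elements\<close>

text \<open>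
  An element \<open>x\<close> that anticommutes with itself satisfies \<open>2 x\<^sup>2 = 0\<close> only, so that the vanishing of
  squares is a separate condition below.
\<close>

definition anticommuting :: "'b::ring \<Rightarrow> 'b \<Rightarrow> bool" where
  "anticommuting x y \<longleftrightarrow> x * y = - (y * x)"

lemma anticommuting_sym: "anticommuting x y \<Longrightarrow> anticommuting y x"
  by (simp add: anticommuting_def)

lemma anticommuting_add_right:
  "anticommuting x y \<Longrightarrow> anticommuting x z \<Longrightarrow> anticommuting x (y + z)"
  by (simp add: anticommuting_def algebra_simps)

lemma anticommuting_sum_right:
  "(\<And>i. i \<in> I \<Longrightarrow> anticommuting x (f i)) \<Longrightarrow> anticommuting x (\<Sum>i\<in>I. f i)"
  by (induction I rule: infinite_finite_induct)
    (auto simp: anticommuting_add_right, simp_all add: anticommuting_def)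

lemma anticommuting_mult_right:
  assumes "anticommuting x y" "x * r = r * x"
  shows "anticommuting x (y * r)"
  using assms unfolding anticommuting_def by (metis minus_mult_left mult.assoc)

lemma anticommuting_prod_list:
  fixes x :: "'b::{ring,monoid_mult}"
  assumes "\<And>y. y \<in> set ys \<Longrightarrow> anticommuting x y"
  shows "x * prod_list ys =
    (if even (length ys) then prod_list ys * x else - (prod_list ys * x))"
  using assms
proof (induction ys)
  case (Cons y ys)
  have "x * prod_list (y # ys) = - (y * (x * prod_list ys))"
    using Cons.prems[of y] by (simp add: anticommuting_def flip: mult.assoc)
  then show ?case using Cons by (simp add: mult.assoc)
qed simp

lemma prod_list_swap_anticommuting:
  fixes x y :: "'b::{ring,monoid_mult}"
  assumes "anticommuting x y"
    and "\<And>z. z \<in> set zs \<Longrightarrow> anticommuting x z" "\<And>z. z \<in> set zs \<Longrightarrow> anticommuting y z"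
  shows "x * prod_list zs * y = - (y * prod_list zs * x)"
proof -
  let ?Z = "prod_list zs"
  have x: "x * ?Z = (if even (length zs) then ?Z * x else - (?Z * x))"
    by (rule anticommuting_prod_list) (rule assms(2))
  have y: "y * ?Z = (if even (length zs) then ?Z * y else - (?Z * y))"
    by (rule anticommuting_prod_list) (rule assms(3))
  have "x * y = - (y * x)" using assms(1) by (simp add: anticommuting_def)
  then have "?Z * x * y = - (?Z * y * x)" by (simp add: mult.assoc)
  then show ?thesis by (simp add: x y)
qed

text \<open>
  The sign of the shuffle that separates the two families depends on their number only. It is
  therefore the same for any two pairs of families of equal length, and never has to be computed.
\<close>

lemma prod_list_shuffle_anticommuting:
  fixes x y :: "nat \<Rightarrow> 'b::{ring,monoid_mult}"
  assumes "\<And>i j. i < n \<Longrightarrow> j < n \<Longrightarrow> anticommuting (x i) (y j)"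
  shows "prod_list (map (\<lambda>i. x i * y i) [0..<n]) =
    (if even (\<Sum>i<n. i) then prod_list (map x [0..<n]) * prod_list (map y [0..<n])
     else - (prod_list (map x [0..<n]) * prod_list (map y [0..<n])))"
  using assms
proof (induction n)
  case (Suc n)
  have "x n * prod_list (map y [0..<n]) =
      (if even n then prod_list (map y [0..<n]) * x n else - (prod_list (map y [0..<n]) * x n))"
    using anticommuting_prod_list[of "map y [0..<n]" "x n"] Suc.prems by force
  then have "prod_list (map y [0..<n]) * (x n * y n) =
      (if even n then x n * (prod_list (map y [0..<n]) * y n)
       else - (x n * (prod_list (map y [0..<n]) * y n)))"
    by (simp add: mult.assoc[symmetric])
  then show ?case
    using Suc by (simp add: mult.assoc)
qed simp

text \<open>Elements of the centre of a ring.\<close>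

definition central :: "'a::times \<Rightarrow> bool" where
  "central z \<longleftrightarrow> (\<forall>x. z * x = x * z)"

lemma centralD: "central z \<Longrightarrow> z * x = x * z"
  by (simp add: central_def)

lemma central_1: "central (1::'a::monoid_mult)"
  by (simp add: central_def)

lemma central_mult: "central y \<Longrightarrow> central z \<Longrightarrow> central (y * z)" for y z :: "'a::semigroup_mult"
  unfolding central_def by (metis mult.assoc)

lemma commute_prod_list:
  fixes x :: "'r::{ring,monoid_mult}"
  assumes "\<And>y. y \<in> set ys \<Longrightarrow> x * y = y * x"
  shows "x * prod_list ys = prod_list ys * x"
  using assms
proof (induction ys)
  case (Cons y ys)
  have "x * y = y * x" "x * prod_list ys = prod_list ys * x" using Cons by auto
  then show ?case unfolding prod_list.Cons by (metis mult.assoc)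
qed simp

section \<open>Exterior families and the column-determinant\<close>

text \<open>
  The defining relations of the generators of an exterior algebra, for the first \<open>n\<close> members of
  a sequence of ring elements. Nothing is said about linear independence.
\<close>

definition exterior_family :: "nat \<Rightarrow> (nat \<Rightarrow> 'b::ring) \<Rightarrow> bool" where
  "exterior_family n \<epsilon> \<longleftrightarrow>
    (\<forall>i<n. \<epsilon> i * \<epsilon> i = 0) \<and> (\<forall>i<n. \<forall>j<n. anticommuting (\<epsilon> i) (\<epsilon> j))"

lemma exterior_family_prod_list_eq_0:
  fixes \<epsilon> :: "nat \<Rightarrow> 'b::{ring,monoid_mult}"
  assumes ext: "exterior_family n \<epsilon>" and "set xs \<subseteq> {..<n}" "\<not> distinct xs"
  shows "prod_list (map \<epsilon> xs) = 0"
proof -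
  obtain as bs cs z where xs: "xs = as @ [z] @ bs @ [z] @ cs"
    using not_distinct_decomp[OF assms(3)] by blast
  let ?B = "prod_list (map \<epsilon> bs)"
  have "\<epsilon> z * ?B = (if even (length (map \<epsilon> bs)) then ?B * \<epsilon> z else - (?B * \<epsilon> z))"
    using ext assms(2) by (intro anticommuting_prod_list) (auto simp: exterior_family_def xs)
  moreover have "?B * \<epsilon> z * \<epsilon> z = 0"
    using ext assms(2) by (simp add: exterior_family_def xs mult.assoc)
  ultimately have "\<epsilon> z * ?B * \<epsilon> z = 0" by simp
  moreover have "prod_list (map \<epsilon> xs) =
      prod_list (map \<epsilon> as) * (\<epsilon> z * ?B * \<epsilon> z) * prod_list (map \<epsilon> cs)"
    by (simp add: xs mult.assoc)
  ultimately show ?thesis by simp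
qed

lemma exterior_family_transpose:
  assumes "exterior_family n \<epsilon>" "a < n" "b < n"
  shows "exterior_family n (\<lambda>i. \<epsilon> (Transposition.transpose a b i))"
proof -
  have "Transposition.transpose a b i < n" if "i < n" for i
    using that assms by (auto simp: transpose_def)
  then show ?thesis using assms(1) by (simp add: exterior_family_def)
qed

lemma prod_list_transpose_anticommuting:
  fixes \<epsilon> :: "nat \<Rightarrow> 'b::{ring,monoid_mult}"
  assumes ext: "exterior_family n \<epsilon>" and "a < b" "b < n"
  shows "prod_list (map (\<lambda>i. \<epsilon> (Transposition.transpose a b i)) [0..<n]) =
    - prod_list (map \<epsilon> [0..<n])"
proof -
  let ?t = "Transposition.transpose a b"
  have split: "[0..<n] = [0..<a] @ [a] @ [Suc a..<b] @ [b] @ [Suc b..<n]"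
  proof -
    have "[0..<n] = [0..<a] @ [a..<n]" using assms upt_add_eq_append[of 0 a "n - a"] by simp
    moreover have "[a..<n] = a # [Suc a..<n]" using assms by (simp add: upt_conv_Cons)
    moreover have "[Suc a..<n] = [Suc a..<b] @ [b..<n]"
      using assms upt_add_eq_append[of "Suc a" b "n - b"] by simp
    moreover have "[b..<n] = b # [Suc b..<n]" using assms by (simp add: upt_conv_Cons)
    ultimately show ?thesis by simp
  qed
  have maps: "map (\<lambda>i. \<epsilon> (?t i)) [0..<a] = map \<epsilon> [0..<a]"
    "map (\<lambda>i. \<epsilon> (?t i)) [Suc a..<b] = map \<epsilon> [Suc a..<b]"
    "map (\<lambda>i. \<epsilon> (?t i)) [Suc b..<n] = map \<epsilon> [Suc b..<n]"
    using assms by (auto simp: transpose_def)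
  have "\<epsilon> b * prod_list (map \<epsilon> [Suc a..<b]) * \<epsilon> a =
      - (\<epsilon> a * prod_list (map \<epsilon> [Suc a..<b]) * \<epsilon> b)"
    using assms by (intro prod_list_swap_anticommuting) (auto simp: exterior_family_def)
  then have "prod_list (map \<epsilon> [0..<a]) *
        (\<epsilon> b * prod_list (map \<epsilon> [Suc a..<b]) * \<epsilon> a) * prod_list (map \<epsilon> [Suc b..<n]) =
      - (prod_list (map \<epsilon> [0..<a]) *
        (\<epsilon> a * prod_list (map \<epsilon> [Suc a..<b]) * \<epsilon> b) * prod_list (map \<epsilon> [Suc b..<n]))"
    by simp
  then show ?thesis
    unfolding split map_append maps by (simp add: mult.assoc)
qed

text \<open>
  Reordering the factors costs the sign of the permutation. By induction along transpositions, for
  all families at once: composing the permutation with a transposition amounts to permuting the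
  family itself.
\<close>

lemma exterior_family_permutes:
  fixes \<epsilon> :: "nat \<Rightarrow> 'b::{ring,monoid_mult}"
  assumes "p permutes {0..<n}" "exterior_family n \<epsilon>"
  shows "prod_list (map (\<lambda>i. \<epsilon> (p i)) [0..<n]) =
    (if evenperm p then prod_list (map \<epsilon> [0..<n]) else - prod_list (map \<epsilon> [0..<n]))"
proof -
  have "finite {0..<n}" by simp
  from assms show ?thesis
  proof (induction p arbitrary: \<epsilon> rule: permutes_induct[OF _ \<open>finite {0..<n}\<close>, consumes 1])
    case 1
    then show ?case by (simp add: evenperm_id)
  next
    case (2 a b p)
    have lt: "a < n" "b < n" using 2 by auto
    have "permutation p" using 2 permutes_imp_permutation by blast
    then have ev: "evenperm (Transposition.transpose a b \<circ> p) \<longleftrightarrow> \<not> evenperm p"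
      using 2 by (simp add: evenperm_comp permutation_swap_id evenperm_swap)
    have swap: "prod_list (map (\<lambda>i. \<epsilon> (Transposition.transpose a b i)) [0..<n]) =
        - prod_list (map \<epsilon> [0..<n])"
    proof (cases "a < b")
      case True
      then show ?thesis using prod_list_transpose_anticommuting 2 lt by blast
    next
      case False
      then have "b < a" using 2 by simp
      then show ?thesis
        using prod_list_transpose_anticommuting[of n \<epsilon> b a] 2 lt
        by (simp add: transpose_commute)
    qed
    show ?case
      using "2.IH"[OF exterior_family_transpose[OF "2.prems" lt]] by (simp add: swap ev[unfolded comp_def])
  qed
qed

text \<open>
  A unital ring homomorphism \<open>L\<close> from a ring of coefficients \<open>'r\<close> to a ring \<open>'b\<close> that is to contain
  anticommuting elements. No injectivity is required.
\<close>

locale coefficient_hom =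
  fixes L :: "'r::{ring,monoid_mult} \<Rightarrow> 'b::{ring,monoid_mult}"
  assumes L_add: "L (x + y) = L x + L y"
    and L_mult: "L (x * y) = L x * L y"
    and L_one: "L 1 = 1"
begin

lemma L_0: "L 0 = 0"
  using L_add[of 0 0] by simp

lemma L_minus: "L (- x) = - L x"
  using L_add[of x "- x"] L_0 by (simp add: eq_neg_iff_add_eq_0 add.commute)

lemma L_diff: "L (x - y) = L x - L y"
  using L_add[of x "- y"] L_minus by simp

lemma L_sum: "L (\<Sum>i\<in>I. f i) = (\<Sum>i\<in>I. L (f i))"
  by (induction I rule: infinite_finite_induct) (auto simp: L_add L_0)

lemma L_prod_list: "L (prod_list xs) = prod_list (map L xs)"
  by (induction xs) (auto simp: L_mult L_one)

text \<open>Exterior families that commute with the (not necessarily commutative) coefficients.\<close>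

definition generators :: "nat \<Rightarrow> (nat \<Rightarrow> 'b) \<Rightarrow> bool" where
  "generators n \<epsilon> \<longleftrightarrow> exterior_family n \<epsilon> \<and> (\<forall>k<n. \<forall>r. L r * \<epsilon> k = \<epsilon> k * L r)"

text \<open>
  The column vector \<open>v\<close> as the element \<open>\<epsilon>\<^sub>0 v\<^sub>0 + \<dots> + \<epsilon>\<^sub>n\<^sub>-\<^sub>1 v\<^sub>n\<^sub>-\<^sub>1\<close> of degree 1.
\<close>

definition comb :: "nat \<Rightarrow> (nat \<Rightarrow> 'b) \<Rightarrow> (nat \<Rightarrow> 'r) \<Rightarrow> 'b" where
  "comb n \<epsilon> v = (\<Sum>l<n. \<epsilon> l * L (v l))"

lemma comb_scale:
  assumes "generators n \<epsilon>"
  shows "L r * comb n \<epsilon> v = comb n \<epsilon> (\<lambda>l. r * v l)"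
  using assms by (auto simp: comb_def sum_distrib_left generators_def L_mult
      mult.assoc[symmetric] intro!: sum.cong)

lemma comb_minus: "comb n \<epsilon> (\<lambda>l. - v l) = - comb n \<epsilon> v"
  by (simp add: comb_def L_minus sum_negf)

lemma comb_mult_right: "comb n \<epsilon> v * L r = comb n \<epsilon> (\<lambda>l. v l * r)"
  by (simp add: comb_def sum_distrib_right L_mult mult.assoc)

lemma comb_add_single:
  assumes "m < n"
  shows "comb n \<epsilon> (\<lambda>l. v l + (if l = m then c else 0)) = comb n \<epsilon> v + \<epsilon> m * L c"
proof -
  have "comb n \<epsilon> (\<lambda>l. v l + (if l = m then c else 0)) =
      comb n \<epsilon> v + (\<Sum>l<n. if l = m then \<epsilon> m * L c else 0)"
    unfolding comb_def sum.distrib[symmetric]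
    by (intro sum.cong refl) (simp add: L_add L_0 distrib_left)
  then show ?thesis using assms by simp
qed

lemma anticommuting_comb:
  assumes gen: "generators n \<epsilon>" "generators n \<zeta>"
    and ac: "\<And>i j. i < n \<Longrightarrow> j < n \<Longrightarrow> anticommuting (\<epsilon> i) (\<zeta> j)"
    and vw: "\<And>i j. i < n \<Longrightarrow> j < n \<Longrightarrow> v i * w j = w j * v i"
  shows "anticommuting (comb n \<epsilon> v) (comb n \<zeta> w)"
proof -
  have "(\<epsilon> i * L (v i)) * (\<zeta> j * L (w j)) = - ((\<zeta> j * L (w j)) * (\<epsilon> i * L (v i)))"
    if ij: "i < n" "j < n" for i j
  proof -
    have "(\<epsilon> i * L (v i)) * (\<zeta> j * L (w j)) = \<epsilon> i * \<zeta> j * L (v i * w j)"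
      using gen ij by (simp add: generators_def L_mult mult.assoc) (metis mult.assoc)
    moreover have "(\<zeta> j * L (w j)) * (\<epsilon> i * L (v i)) = \<zeta> j * \<epsilon> i * L (w j * v i)"
      using gen ij by (simp add: generators_def L_mult mult.assoc) (metis mult.assoc)
    ultimately show ?thesis
      using ac[OF ij] vw[OF ij] by (simp add: anticommuting_def)
  qed
  then have "comb n \<epsilon> v * comb n \<zeta> w =
      (\<Sum>i<n. \<Sum>j<n. - ((\<zeta> j * L (w j)) * (\<epsilon> i * L (v i))))"
    by (auto simp: comb_def sum_product intro!: sum.cong)
  also have "\<dots> = - (comb n \<zeta> w * comb n \<epsilon> v)"
    by (subst sum.swap) (simp add: comb_def sum_product sum_negf)
  finally show ?thesis by (simp add: anticommuting_def)
qed

lemma anticommuting_comb_right: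
  assumes gen: "generators n \<zeta>"
    and "\<And>i. i < n \<Longrightarrow> anticommuting x (\<zeta> i)" "\<And>r. x * L r = L r * x"
  shows "anticommuting x (comb n \<zeta> v)"
  unfolding comb_def using assms
  by (intro anticommuting_sum_right anticommuting_mult_right) auto

lemma generators_prod_list_commute:
  assumes "generators n \<epsilon>" "set xs \<subseteq> {..<n}"
  shows "L r * prod_list (map \<epsilon> xs) = prod_list (map \<epsilon> xs) * L r"
  using assms by (intro commute_prod_list) (auto simp: generators_def)

lemma prod_list_comb:
  assumes "generators n \<epsilon>"
  shows "prod_list (map (\<lambda>j. comb n \<epsilon> (\<lambda>i. m i j)) js) =
    (\<Sum>xs | length xs = length js \<and> set xs \<subseteq> {..<n}.
      prod_list (map \<epsilon> xs) * L (prod_list (map2 m xs js)))"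
proof (induction js)
  case Nil
  have "{xs::nat list. xs = [] \<and> set xs \<subseteq> {..<n}} = {[]}" by auto
  then show ?case by (simp add: L_one)
next
  case (Cons j js)
  let ?A = "{xs. length xs = length js \<and> set xs \<subseteq> {..<n}}"
  have "{xs. length xs = length (j # js) \<and> set xs \<subseteq> {..<n}} =
      (\<lambda>(x, xs). x # xs) ` ({..<n} \<times> ?A)"
    by (force simp: length_Suc_conv image_iff)
  moreover have "inj_on (\<lambda>(x, xs). x # xs) ({..<n} \<times> ?A)" by (auto simp: inj_on_def)
  ultimately have "(\<Sum>xs | length xs = length (j # js) \<and> set xs \<subseteq> {..<n}.
      prod_list (map \<epsilon> xs) * L (prod_list (map2 m xs (j # js)))) =
      (\<Sum>(x, xs)\<in>{..<n} \<times> ?A. \<epsilon> x * prod_list (map \<epsilon> xs) *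
        (L (m x j) * L (prod_list (map2 m xs js))))"
    by (simp add: sum.reindex case_prod_unfold L_mult)
  also have "\<dots> = (\<Sum>(x, xs)\<in>{..<n} \<times> ?A. (\<epsilon> x * L (m x j)) *
        (prod_list (map \<epsilon> xs) * L (prod_list (map2 m xs js))))"
  proof (intro sum.cong refl, clarsimp)
    fix x and xs :: "nat list"
    assume "set xs \<subseteq> {..<n}"
    then have "prod_list (map \<epsilon> xs) * L (m x j) = L (m x j) * prod_list (map \<epsilon> xs)"
      using generators_prod_list_commute[OF assms] by simp
    then show "\<epsilon> x * prod_list (map \<epsilon> xs) * (L (m x j) * L (prod_list (map2 m xs js))) =
        \<epsilon> x * L (m x j) * (prod_list (map \<epsilon> xs) * L (prod_list (map2 m xs js)))"
      by (metis mult.assoc)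
  qed
  also have "\<dots> = comb n \<epsilon> (\<lambda>i. m i j) * prod_list (map (\<lambda>j. comb n \<epsilon> (\<lambda>i. m i j)) js)"
    unfolding Cons by (simp add: comb_def sum_product sum.cartesian_product)
  finally show ?case by simp
qed

text \<open>
  The column-determinant is the coefficient of the top form in the product of the columns, taken
  in their order. Index lists with a repetition contribute nothing; the others are permutations.
\<close>

lemma prod_list_comb_eq_det_col:
  assumes gen: "generators n \<epsilon>" and M: "M \<in> carrier_mat n n"
  shows "prod_list (map (\<lambda>j. comb n \<epsilon> (\<lambda>i. M $$ (i, j))) [0..<n]) =
    prod_list (map \<epsilon> [0..<n]) * L (det_col M)"
proof -
  let ?S = "{xs. length xs = length [0..<n] \<and> set xs \<subseteq> {..<n}}"
  let ?P = "{p. p permutes {0..<n}}"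
  let ?g = "\<lambda>p. map p [0..<n]"
  let ?F = "\<lambda>xs. prod_list (map \<epsilon> xs) *
    L (prod_list (map2 (\<lambda>i j. M $$ (i, j)) xs [0..<n]))"
  have fin: "finite ?S" using finite_lists_length_eq[of "{..<n}" n]
    by (simp add: conj_commute)
  have ext: "exterior_family n \<epsilon>" using gen by (simp add: generators_def)
  have inj: "inj_on ?g ?P"
  proof (rule inj_onI)
    fix p q assume pq: "p \<in> ?P" "q \<in> ?P" "?g p = ?g q"
    then show "p = q" by (auto simp: fun_eq_iff permutes_def)
  qed
  have img: "?g ` ?P = {xs \<in> ?S. distinct xs}"
  proof (intro equalityI subsetI)
    fix xs assume "xs \<in> ?g ` ?P"
    then obtain p where p: "p permutes {0..<n}" "xs = ?g p" by blast
    then show "xs \<in> {xs \<in> ?S. distinct xs}"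
      using permutes_in_image[OF p(1)] permutes_inj_on[OF p(1)]
      by (force simp: distinct_map)
  next
    fix xs assume xs: "xs \<in> {xs \<in> ?S. distinct xs}"
    let ?p = "\<lambda>i. if i < n then xs ! i else i"
    have "inj_on ?p {0..<n}" using xs by (auto simp: inj_on_def nth_eq_iff_index_eq)
    moreover have "?p ` {0..<n} \<subseteq> {0..<n}"
    proof -
      have "xs ! i < n" if "i < n" for i
        using xs that nth_mem[of i xs] by (auto simp: subset_iff)
      then show ?thesis by auto
    qed
    ultimately have "bij_betw ?p {0..<n} {0..<n}"
      unfolding bij_betw_def using endo_inj_surj[of "{0..<n}" ?p] by blast
    then have "?p permutes {0..<n}" by (rule bij_imp_permutes) auto
    moreover have "xs = ?g ?p" using xs by (auto intro!: nth_equalityI)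
    ultimately show "xs \<in> ?g ` ?P" by blast
  qed
  have "prod_list (map (\<lambda>j. comb n \<epsilon> (\<lambda>i. M $$ (i, j))) [0..<n]) = sum ?F ?S"
    by (rule prod_list_comb[OF gen])
  also have "\<dots> = sum ?F {xs \<in> ?S. distinct xs}"
    using fin exterior_family_prod_list_eq_0[OF ext]
    by (intro sum.mono_neutral_right) auto
  also have "\<dots> = (\<Sum>p\<in>?P. ?F (?g p))"
    using sum.reindex[OF inj, of ?F] by (simp only: img comp_def)
  also have "\<dots> = (\<Sum>p\<in>?P. prod_list (map \<epsilon> [0..<n]) *
      L (let x = prod_list (map (\<lambda>j. M $$ (p j, j)) [0..<n])
         in if evenperm p then x else - x))"
  proof (rule sum.cong[OF refl])
    fix p assume "p \<in> ?P"
    then have "prod_list (map \<epsilon> (?g p)) =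
        (if evenperm p then prod_list (map \<epsilon> [0..<n]) else - prod_list (map \<epsilon> [0..<n]))"
      using exterior_family_permutes[OF _ ext, of p] by (simp add: comp_def)
    moreover have "map2 (\<lambda>i j. M $$ (i, j)) (?g p) [0..<n] = map (\<lambda>j. M $$ (p j, j)) [0..<n]"
      by (auto intro!: nth_equalityI)
    ultimately show "?F (?g p) = prod_list (map \<epsilon> [0..<n]) *
      L (let x = prod_list (map (\<lambda>j. M $$ (p j, j)) [0..<n])
         in if evenperm p then x else - x)"
      by (simp add: Let_def L_minus)
  qed
  also have "\<dots> = prod_list (map \<epsilon> [0..<n]) * L (det_col M)"
    using M by (simp add: det_col_def L_sum sum_distrib_left)
  finally show ?thesis .
qed

end

section \<open>Vanishing for reasons of degree\<close>

text \<open>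
  Every monomial of length \<open>k\<close> in \<open>\<zeta>\<^sub>0, \<dots>, \<zeta>\<^sub>n\<^sub>-\<^sub>1\<close> annihilates \<open>z\<close>, multiplying from the left. This
  stands for \<open>z\<close> having degree at least \<open>n + 1 - k\<close> in \<open>\<zeta>\<close>, but needs no grading of the ring. The
  smaller \<open>k\<close>, the stronger the condition; for \<open>k = 0\<close> it says \<open>z = 0\<close>.
\<close>

definition killed_by_degree :: "(nat \<Rightarrow> 'b::{ring,monoid_mult}) \<Rightarrow> nat \<Rightarrow> nat \<Rightarrow> 'b \<Rightarrow> bool" where
  "killed_by_degree \<zeta> n k z \<longleftrightarrow>
    (\<forall>xs. length xs = k \<longrightarrow> set xs \<subseteq> {..<n} \<longrightarrow> prod_list (map \<zeta> xs) * z = 0)"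

lemma killed_by_degree_0: "killed_by_degree \<zeta> n 0 z \<Longrightarrow> z = 0"
  by (simp add: killed_by_degree_def)

lemma killed_by_degree_add:
  "killed_by_degree \<zeta> n k y \<Longrightarrow> killed_by_degree \<zeta> n k z \<Longrightarrow> killed_by_degree \<zeta> n k (y + z)"
  by (simp add: killed_by_degree_def distrib_left)

lemma killed_by_degree_Suc:
  assumes "killed_by_degree \<zeta> n k z"
  shows "killed_by_degree \<zeta> n (Suc k) z"
  unfolding killed_by_degree_def
proof (intro allI impI)
  fix xs assume "length xs = Suc k" "set xs \<subseteq> {..<n}"
  then show "prod_list (map \<zeta> xs) * z = 0"
    using assms by (cases xs) (auto simp: killed_by_degree_def mult.assoc)
qed

lemma killed_by_degree_mult_anticommuting:
  assumes "killed_by_degree \<zeta> n k z" "\<And>l. l < n \<Longrightarrow> anticommuting u (\<zeta> l)"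
  shows "killed_by_degree \<zeta> n k (u * z)"
  unfolding killed_by_degree_def
proof (intro allI impI)
  fix xs assume xs: "length xs = k" "set xs \<subseteq> {..<n}"
  let ?Z = "prod_list (map \<zeta> xs)"
  have "u * ?Z = (if even (length (map \<zeta> xs)) then ?Z * u else - (?Z * u))"
    using xs assms(2) by (intro anticommuting_prod_list) auto
  moreover have "u * (?Z * z) = 0"
    using assms(1) xs by (simp add: killed_by_degree_def)
  ultimately show "?Z * (u * z) = 0"
    by (simp add: mult.assoc[symmetric] split: if_splits)
qed

lemma killed_by_degree_one:
  assumes "exterior_family n \<zeta>"
  shows "killed_by_degree \<zeta> n (Suc n) 1"
  unfolding killed_by_degree_def
proof (intro allI impI)
  fix xs assume xs: "length xs = Suc n" "set xs \<subseteq> {..<n}"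
  have "card (set xs) \<le> card {..<n}" using xs by (intro card_mono) auto
  then have "\<not> distinct xs" using xs by (auto simp: distinct_card)
  then show "prod_list (map \<zeta> xs) * 1 = 0"
    using exterior_family_prod_list_eq_0[OF assms] xs by simp
qed

context coefficient_hom
begin

lemma killed_by_degree_comb:
  assumes gen: "generators n \<zeta>" and z: "killed_by_degree \<zeta> n (Suc k) z"
  shows "killed_by_degree \<zeta> n k (comb n \<zeta> v * z)"
  unfolding killed_by_degree_def
proof (intro allI impI)
  fix xs assume xs: "length xs = k" "set xs \<subseteq> {..<n}"
  let ?Z = "prod_list (map \<zeta> xs)"
  have "?Z * (\<zeta> l * L (v l) * z) = 0" if "l < n" for l
  proof -
    have "L (v l) * prod_list (map \<zeta> (xs @ [l])) = prod_list (map \<zeta> (xs @ [l])) * L (v l)"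
      using generators_prod_list_commute[OF gen, of "xs @ [l]"] xs that by simp
    then have "?Z * (\<zeta> l * L (v l) * z) = L (v l) * (prod_list (map \<zeta> (xs @ [l])) * z)"
      by (simp add: mult.assoc[symmetric])
    also have "\<dots> = 0"
      using z[unfolded killed_by_degree_def, rule_format, of "xs @ [l]"] xs that by simp
    finally show ?thesis .
  qed
  then show "?Z * (comb n \<zeta> v * z) = 0"
    by (simp add: comb_def sum_distrib_left sum_distrib_right)
qed

text \<open>
  Each factor \<open>(u + q) v\<close> with \<open>q\<close> and \<open>v\<close> in the span of \<open>\<zeta>\<close> has degree at least 1 in \<open>\<zeta>\<close>, and
  its summand \<open>q v\<close> has degree 2. Replacing \<open>(u + q) v\<close> by \<open>u v\<close> in all factors of a product thus
  changes terms of degree greater than the number of factors only.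
\<close>

lemma prod_list_quadratic_degree:
  assumes gen: "generators n \<zeta>"
    and u: "\<And>m l. m \<in> set ms \<Longrightarrow> l < n \<Longrightarrow> anticommuting (u m) (\<zeta> l)"
    and k: "n \<le> k + length ms"
  shows "killed_by_degree \<zeta> n (Suc k)
      (prod_list (map (\<lambda>m. (u m + comb n \<zeta> (v' m)) * comb n \<zeta> (v m)) ms)) \<and>
    killed_by_degree \<zeta> n k
      (prod_list (map (\<lambda>m. (u m + comb n \<zeta> (v' m)) * comb n \<zeta> (v m)) ms) -
       prod_list (map (\<lambda>m. u m * comb n \<zeta> (v m)) ms))"
  using u k
proof (induction ms arbitrary: k)
  case Nil
  have one: "killed_by_degree \<zeta> n (Suc k) 1" if "n \<le> k" for k
    using that
  proof (induction k rule: dec_induct)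
    case base
    then show ?case using killed_by_degree_one gen by (auto simp: generators_def)
  next
    case (step k)
    then show ?case using killed_by_degree_Suc by blast
  qed
  from this[of k] show ?case using Nil by (simp add: killed_by_degree_def)
next
  case (Cons m ms)
  let ?V = "comb n \<zeta> (v m)" and ?Q = "comb n \<zeta> (v' m)"
  let ?W = "prod_list (map (\<lambda>m. (u m + comb n \<zeta> (v' m)) * comb n \<zeta> (v m)) ms)"
  let ?D = "?W - prod_list (map (\<lambda>m. u m * comb n \<zeta> (v m)) ms)"
  have ac: "anticommuting (u m) (\<zeta> l)" if "l < n" for l using Cons.prems that by simp
  have IH: "killed_by_degree \<zeta> n (Suc (Suc k)) ?W" "killed_by_degree \<zeta> n (Suc k) ?D"
    using Cons.IH[of "Suc k"] Cons.prems by auto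
  have 1: "killed_by_degree \<zeta> n (Suc k) (u m * (?V * ?W))"
    using IH ac by (intro killed_by_degree_mult_anticommuting killed_by_degree_comb[OF gen])
  have 2: "killed_by_degree \<zeta> n k (?Q * (?V * ?W))"
    using IH by (intro killed_by_degree_comb[OF gen])
  have 3: "killed_by_degree \<zeta> n k (u m * (?V * ?D))"
    using IH ac by (intro killed_by_degree_mult_anticommuting killed_by_degree_comb[OF gen])
  show ?case
    using killed_by_degree_add[OF 1 killed_by_degree_Suc[OF 2]] killed_by_degree_add[OF 3 2]
    by (simp add: algebra_simps)
qed

lemma prod_list_quadratic_top_degree:
  assumes "generators n \<zeta>" "\<And>m l. m < n \<Longrightarrow> l < n \<Longrightarrow> anticommuting (u m) (\<zeta> l)"
  shows "prod_list (map (\<lambda>m. (u m + comb n \<zeta> (v' m)) * comb n \<zeta> (v m)) [0..<n]) =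
    prod_list (map (\<lambda>m. u m * comb n \<zeta> (v m)) [0..<n])"
  using prod_list_quadratic_degree[OF assms(1), of "[0..<n]" u 0 v' v] assms(2)
  by (auto dest: killed_by_degree_0)

section \<open>The two columns of a block\<close>

text \<open>
  The square of a column would vanish if its entries commuted with each other. Their commutators
  leave one term. The square only yields twice the assertion, whence the hypothesis on \<open>h\<close>.
\<close>

lemma comb_square:
  assumes gen: "generators n \<theta>" and m: "m < n" and half: "(h::'r) + h = 1"
    and E: "\<And>l l'. l < n \<Longrightarrow> l' < n \<Longrightarrow>
      v l * v l' - v l' * v l = (if l' = m then v l else 0) - (if l = m then v l' else 0)"
  shows "comb n \<theta> v * comb n \<theta> v = comb n \<theta> v * \<theta> m"
proof -
  let ?F = "comb n \<theta> v"
  have ac: "\<theta> l * \<theta> l' = - (\<theta> l' * \<theta> l)" if "l < n" "l' < n" for l l'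
    using gen that unfolding generators_def exterior_family_def anticommuting_def by blast
  have c: "L r * \<theta> l = \<theta> l * L r" if "l < n" for l r
    using gen that by (simp add: generators_def)
  have F: "?F * ?F = (\<Sum>l<n. \<Sum>l'<n. \<theta> l * \<theta> l' * L (v l * v l'))"
    unfolding comb_def sum_product
  proof (intro sum.cong refl)
    fix l l' assume "l \<in> {..<n}" "l' \<in> {..<n}"
    then have "L (v l) * \<theta> l' = \<theta> l' * L (v l)" using c by simp
    then show "\<theta> l * L (v l) * (\<theta> l' * L (v l')) = \<theta> l * \<theta> l' * L (v l * v l')"
      unfolding L_mult by (metis mult.assoc)
  qed
  have F': "?F * ?F = - (\<Sum>l<n. \<Sum>l'<n. \<theta> l * \<theta> l' * L (v l' * v l))"
  proof -
    have "?F * ?F = (\<Sum>l<n. \<Sum>l'<n. - (\<theta> l * \<theta> l' * L (v l' * v l)))"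
      unfolding F
    proof (subst sum.swap, intro sum.cong refl)
      fix l l' assume "l \<in> {..<n}" "l' \<in> {..<n}"
      then show "\<theta> l' * \<theta> l * L (v l' * v l) = - (\<theta> l * \<theta> l' * L (v l' * v l))"
        using ac[of l' l] by simp
    qed
    then show ?thesis by (simp add: sum_negf)
  qed
  have t: "?F * \<theta> m = (\<Sum>l<n. \<theta> l * \<theta> m * L (v l))"
    by (simp add: comb_def sum_distrib_right mult.assoc c m)
  have "?F * ?F + ?F * ?F = (\<Sum>l<n. \<Sum>l'<n. \<theta> l * \<theta> l' * L (v l * v l' - v l' * v l))"
    using F F' by (simp add: L_diff right_diff_distrib sum_subtractf)
  also have "\<dots> = (\<Sum>l<n. \<Sum>l'<n. (if l' = m then \<theta> l * \<theta> m * L (v l) else 0)) -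
      (\<Sum>l<n. \<Sum>l'<n. (if l = m then \<theta> m * \<theta> l' * L (v l') else 0))"
    unfolding sum_subtractf[symmetric]
    by (intro sum.cong refl) (auto simp: E L_diff L_0 right_diff_distrib)
  also have "(\<Sum>l<n. \<Sum>l'<n. (if l' = m then \<theta> l * \<theta> m * L (v l) else 0)) = ?F * \<theta> m"
    using m by (simp add: t)
  also have "(\<Sum>l<n. \<Sum>l'<n. (if l = m then \<theta> m * \<theta> l' * L (v l') else 0)) = - (?F * \<theta> m)"
  proof -
    have "(\<Sum>l<n. \<Sum>l'<n. (if l = m then \<theta> m * \<theta> l' * L (v l') else 0)) =
        (\<Sum>l'<n. \<theta> m * \<theta> l' * L (v l'))"
      using m by (subst sum.swap) simp
    also have "\<dots> = (\<Sum>l'<n. - (\<theta> l' * \<theta> m * L (v l')))"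
    proof (intro sum.cong refl)
      fix l' assume "l' \<in> {..<n}"
      then show "\<theta> m * \<theta> l' * L (v l') = - (\<theta> l' * \<theta> m * L (v l'))"
        using ac[OF m, of l'] by simp
    qed
    finally show ?thesis by (simp add: t sum_negf)
  qed
  finally have "?F * ?F + ?F * ?F = ?F * \<theta> m + ?F * \<theta> m" by simp
  then have "L h * (?F * ?F + ?F * ?F) = L h * (?F * \<theta> m + ?F * \<theta> m)" by simp
  then have "L (h + h) * (?F * ?F) = L (h + h) * (?F * \<theta> m)"
    by (simp only: L_add distrib_left distrib_right)
  then show ?thesis by (simp add: half L_one)
qed

text \<open>
  If the shift \<open>c\<close> is split as \<open>c \<plusminus> 1/2\<close> between two copies of the same column, the term left by
  the commutators cancels. Here \<open>h\<close> is one half.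
\<close>

lemma shifted_column_factorisation:
  assumes gen: "generators n \<theta>" and m: "m < n" and half: "(h::'r) + h = 1"
    and h: "central h" and c: "central c"
    and E: "\<And>l l'. l < n \<Longrightarrow> l' < n \<Longrightarrow>
      v l * v l' - v l' * v l = (if l' = m then v l else 0) - (if l = m then v l' else 0)"
  defines "U \<equiv> comb n \<theta> (\<lambda>l. v l + (if l = m then c else 0))"
  shows "(U + \<theta> m * L h) * (U - \<theta> m * L h) = 0"
proof -
  let ?F = "comb n \<theta> v"
  let ?t = "\<theta> m" and ?H = "L h" and ?C = "L c"
  have U: "U = ?F + ?t * ?C"
    unfolding U_def by (rule comb_add_single[OF m])
  have tL: "L r * ?t = ?t * L r" for r
    using gen m by (simp add: generators_def)
  have tt: "?t * ?t = 0"
    using gen m by (simp add: generators_def exterior_family_def)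
  have "anticommuting ?t ?F"
    using gen m tL by (intro anticommuting_comb_right[OF gen])
      (auto simp: generators_def exterior_family_def)
  then have tF: "?t * ?F = - (?F * ?t)" by (simp add: anticommuting_def)
  have FF: "?F * ?F = ?F * ?t" by (rule comb_square[OF gen m half E])
  have LF: "L r * ?F = ?F * L r" if "central r" for r
    by (simp add: comb_scale[OF gen] comb_mult_right centralD[OF that])
  have ttL: "?t * L r * ?t = 0" for r by (metis tL tt mult.assoc mult_zero_left mult_zero_right)
  have tLF: "?t * L r * ?F = - (?F * ?t * L r)" if "central r" for r
    by (metis LF[OF that] tF mult.assoc minus_mult_left)
  have exp: "(?F + ?t * L r) * (?F + ?t * L s) = ?F * ?t + ?F * ?t * L s - ?F * ?t * L r"
    if "central r" for r s
  proof -
    have "(?F + ?t * L r) * (?F + ?t * L s) =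
        ?F * ?F + ?F * ?t * L s + ?t * L r * ?F + ?t * L r * ?t * L s"
      by (simp add: algebra_simps)
    then show ?thesis by (simp add: FF tLF[OF that] ttL)
  qed
  have ch: "central (c + h)"
    using h c by (simp add: central_def distrib_left distrib_right)
  have "(U + ?t * ?H) * (U - ?t * ?H) = (?F + ?t * L (c + h)) * (?F + ?t * L (c - h))"
    by (simp add: U L_add L_diff algebra_simps)
  also have "\<dots> = ?F * ?t * (1 - L (h + h))"
    by (simp add: exp[OF ch]) (simp add: L_add L_diff algebra_simps)
  finally show ?thesis by (simp add: half L_one)
qed

end

text \<open>
  The left-hand side is the product of the two columns of a block in the coordinates adapted to the
  complex structure; \<open>I\<close> plays the role of \<open>i\<close>, and \<open>H\<close> that of one half.
\<close>

lemma product_of_block_columns: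
  fixes U V t H I :: "'b::{ring,monoid_mult}"
  assumes UV: "anticommuting U V" and tV: "anticommuting t V"
    and H: "H * U = U * H" "H * V = V * H" "H * t = t * H"
    and I: "I * U = U * I" "I * V = V * I" "I * t = t * I"
    and IH: "I * H = H * I" "I * I = - 1" "H + H = 1"
    and fact: "(U + t * H) * (U - t * H) = 0"
  shows "((U + t * H) * H - I * V) * (V - I * H * (U - t * H)) = (U - I * V) * V"
proof -
  define A B where "A = U + t * H" and "B = U - t * H"
  have AH: "A * H = H * A"
    using H by (simp add: A_def algebra_simps) (metis mult.assoc)
  have AB: "A * B = 0" using fact by (simp add: A_def B_def)
  have AI: "A * I = I * A"
    using I IH by (simp add: A_def algebra_simps) (metis mult.assoc)
  have VB: "V * B = - (B * V)"
  proof -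
    have "V * (t * H) = - (t * H * V)"
      by (metis H(2) tV anticommuting_def anticommuting_sym minus_mult_left mult.assoc)
    moreover have "V * U = - (U * V)"
      using UV by (simp add: anticommuting_def)
    ultimately show ?thesis
      by (simp add: B_def algebra_simps)
  qed
  have "A * H * I * H * B = H * I * H * (A * B)"
    by (metis AH AI mult.assoc)
  then have mixed: "A * H * (I * H * B) = 0"
    using AB by (simp add: mult.assoc)
  have last: "I * V * (I * H * B) = H * B * V"
  proof -
    have "I * V * (I * H * B) = I * I * (H * (V * B))"
      by (metis I(2) H(2) mult.assoc)
    then show ?thesis
      by (simp add: IH(2) VB mult.assoc)
  qed
  have "(A * H - I * V) * (V - I * H * B) = A * H * V - I * V * V + H * B * V"
    by (simp only: left_diff_distrib right_diff_distrib mixed last) simp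
  also have "\<dots> = H * (A + B) * V - I * V * V"
    by (simp add: AH algebra_simps)
  also have "H * (A + B) = U"
  proof -
    have "H * (A + B) = (H + H) * U" by (simp add: A_def B_def algebra_simps)
    then show ?thesis using IH(3) by simp
  qed
  finally show ?thesis by (simp add: A_def B_def left_diff_distrib)
qed

section \<open>Matrices of two by two blocks\<close>

lemma sum_lessThan_double:
  fixes f :: "nat \<Rightarrow> 'b::ring"
  shows "(\<Sum>r<2 * n. f r) = (\<Sum>l<n. f (2 * l) + f (2 * l + 1))"
  by (induction n) (simp_all add: add.assoc)

lemma prod_list_upt_double:
  fixes f :: "nat \<Rightarrow> 'b::{ring,monoid_mult}"
  shows "prod_list (map f [0..<2 * n]) = prod_list (map (\<lambda>m. f (2 * m) * f (2 * m + 1)) [0..<n])"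
  by (induction n) (simp_all add: mult.assoc)

context coefficient_hom
begin

text \<open>
  New generators from the pairs \<open>e\<^sub>2\<^sub>l, e\<^sub>2\<^sub>l\<^sub>+\<^sub>1\<close> of old ones, with coefficients \<open>r\<close> and \<open>s\<close> that do
  not depend on \<open>l\<close>.
\<close>

definition pair_comb :: "(nat \<Rightarrow> 'b) \<Rightarrow> 'r \<Rightarrow> 'r \<Rightarrow> nat \<Rightarrow> 'b" where
  "pair_comb e r s l = e (2 * l) * L r + e (2 * l + 1) * L s"

lemma anticommuting_pair_comb:
  assumes gen: "generators (2 * n) e" and l: "l < n" "l' < n"
    and central: "central r" "central s" "central r'" "central s'"
  shows "anticommuting (pair_comb e r s l) (pair_comb e r' s' l')"
proof -
  have c: "L r * e k = e k * L r" if "k < 2 * n" for k r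
    using gen that by (simp add: generators_def)
  have ac: "anticommuting (e j * L p) (e k * L q)"
    if "j < 2 * n" "k < 2 * n" "central q" for j k p q
  proof (intro anticommuting_mult_right)
    show "anticommuting (e j * L p) (e k)"
      using gen that c by (intro anticommuting_sym[OF anticommuting_mult_right])
        (auto simp: generators_def exterior_family_def)
    show "e j * L p * L q = L q * (e j * L p)"
      using centralD[OF that(3), of p] c[OF that(1), of q] by (metis L_mult mult.assoc)
  qed
  have *: "anticommuting (e j * L p) (pair_comb e r' s' l')"
    if "j < 2 * n" for j p
    unfolding pair_comb_def using l that central
    by (intro anticommuting_add_right ac) auto
  show ?thesis
    unfolding pair_comb_def[of e r s] using l central
    by (intro anticommuting_sym[OF anticommuting_add_right] anticommuting_sym[OF *]) auto
qed

lemma generators_pair_comb: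
  assumes gen: "generators (2 * n) e"
    and central: "central r" "central s"
  shows "generators n (pair_comb e r s)"
proof -
  have c: "L r * e k = e k * L r" if "k < 2 * n" for k r
    using gen that by (simp add: generators_def)
  have 1: "pair_comb e r s l * pair_comb e r s l = 0" if l: "l < n" for l
  proof -
    let ?x = "e (2 * l)" and ?y = "e (2 * l + 1)"
    have lt: "2 * l < 2 * n" "2 * l + 1 < 2 * n" using l by auto
    have sq: "?x * ?x = 0" "?y * ?y = 0" and ac: "?x * ?y = - (?y * ?x)"
      using gen lt unfolding generators_def exterior_family_def anticommuting_def by blast+
    have mult: "(e j * L p) * (e k * L q) = e j * e k * L (p * q)" if "k < 2 * n" for j k p q
      using c[OF that, of p] by (metis L_mult mult.assoc)
    show ?thesis
      unfolding pair_comb_def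
      by (simp only: distrib_left distrib_right mult[OF lt(1)] mult[OF lt(2)] sq ac)
        (simp add: centralD[OF central(1), of s])
  qed
  have 2: "L t * pair_comb e r s l = pair_comb e r s l * L t" if l: "l < n" for l t
  proof -
    have "L t * (e k * L p) = e k * L p * L t" if "k < 2 * n" "central p" for k p
      using c[OF that(1), of t] centralD[OF that(2), of t] by (metis L_mult mult.assoc)
    then show ?thesis using l central by (simp add: pair_comb_def distrib_left distrib_right)
  qed
  show ?thesis
    unfolding generators_def exterior_family_def
    using 1 2 anticommuting_pair_comb[OF gen] central by blast
qed

text \<open>
  The theorem with abstract coefficients, up to cancellation of the top form. In the application
  \<open>x\<close> and \<open>y\<close> are the entries of \<open>E\<close> and of its conjugate, \<open>h\<close> is one half and \<open>c m\<close> is the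
  shift in column \<open>m\<close>.
\<close>

lemma det_col_blocks:
  fixes x y :: "nat \<Rightarrow> nat \<Rightarrow> 'r" and i h :: 'r and c :: "nat \<Rightarrow> 'r"
  assumes gen: "generators (2 * n) e"
    and i_central: "central i" and h_central: "central h" and c_central: "\<And>m. central (c m)"
    and ii: "i * i = - 1" and half: "h + h = 1"
    and xx: "\<And>l l' m. l < n \<Longrightarrow> l' < n \<Longrightarrow> m < n \<Longrightarrow> x l m * x l' m - x l' m * x l m =
      (if l' = m then x l m else 0) - (if l = m then x l' m else 0)"
    and xy: "\<And>j k l m. j < n \<Longrightarrow> k < n \<Longrightarrow> l < n \<Longrightarrow> m < n \<Longrightarrow> x j k * y l m = y l m * x j k"
    and M: "M \<in> carrier_mat (2 * n) (2 * n)"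
    and M00: "\<And>l m. l < n \<Longrightarrow> m < n \<Longrightarrow> M $$ (2 * l, 2 * m) =
      h * (x l m + y l m) + (if l = m then c m + h * h else 0)"
    and M10: "\<And>l m. l < n \<Longrightarrow> m < n \<Longrightarrow> M $$ (2 * l + 1, 2 * m) =
      i * h * (x l m - y l m) + (if l = m then i * h * h else 0)"
    and M01: "\<And>l m. l < n \<Longrightarrow> m < n \<Longrightarrow> M $$ (2 * l, 2 * m + 1) =
      - (i * h * (x l m - y l m)) + (if l = m then i * h * h else 0)"
    and M11: "\<And>l m. l < n \<Longrightarrow> m < n \<Longrightarrow> M $$ (2 * l + 1, 2 * m + 1) =
      h * (x l m + y l m) + (if l = m then c m - h * h else 0)"
  shows "prod_list (map e [0..<2 * n]) * L (det_col M) =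
    prod_list (map e [0..<2 * n]) *
      L (det_col (mat n n (\<lambda>(l, m). x l m + (if l = m then c m else 0))) *
         det_col (mat n n (\<lambda>(l, m). y l m + (if l = m then c m else 0))))"
proof -
  \<comment> \<open>The factor \<open>h\<close> in \<open>\<zeta>\<close> makes \<open>e\<^sub>2\<^sub>l e\<^sub>2\<^sub>l\<^sub>+\<^sub>1 = \<theta>\<^sub>l \<zeta>\<^sub>l\<close>, without powers of 2 and of \<open>i\<close>.\<close>
  define \<theta> \<zeta> where "\<theta> = pair_comb e 1 i" and "\<zeta> = pair_comb e (h * i) h"
  define X where "X = (\<lambda>m l. x l m + (if l = m then c m else 0))"
  define Y where "Y = (\<lambda>m l. y l m + (if l = m then c m else 0))"
  let ?H = "L h" and ?I = "L i"
  note h_comm = centralD[OF h_central] and i_comm = centralD[OF i_central]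
    and c_comm = centralD[OF c_central]
  have hi_central: "central (h * i)"
    by (intro central_mult h_central i_central)
  have gen\<theta>: "generators n \<theta>" and gen\<zeta>: "generators n \<zeta>"
    unfolding \<theta>_def \<zeta>_def using gen i_central h_central hi_central central_1
    by (auto intro!: generators_pair_comb)
  have ac\<theta>\<zeta>: "anticommuting (\<theta> k) (\<zeta> l)" if "k < n" "l < n" for k l
    unfolding \<theta>_def \<zeta>_def using gen i_central h_central hi_central central_1 that
    by (auto intro!: anticommuting_pair_comb)
  have ih: "i * h = h * i" by (rule i_comm)
  have ihi: "i * (h * i) = - h" by (metis ih ii mult.assoc mult_minus_right mult.right_neutral)
  have h_i: "h * i = i * h" by (rule ih[symmetric])
  have h_i_mult: "h * (i * z) = i * (h * z)" for z by (metis ih mult.assoc)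
  have hhz: "h * z + h * z = z" for z
    using half by (metis distrib_right mult_1)
  \<comment> \<open>The coordinates \<open>(p, q)\<close> in block \<open>l\<close> of a vector with coordinates \<open>(u, w)\<close> for \<open>\<theta>\<close> and \<open>\<zeta>\<close>.\<close>
  have coord: "e (2 * l) * L p + e (2 * l + 1) * L q = \<theta> l * L u + \<zeta> l * L w"
    if "p = u + h * i * w" "q = i * u + h * w" for l p q u w
    by (simp add: that \<theta>_def \<zeta>_def pair_comb_def L_add L_mult L_one algebra_simps)
  have column: "comb (2 * n) e (\<lambda>r. M $$ (r, s)) = comb n \<theta> u + comb n \<zeta> w"
    if "\<And>l. l < n \<Longrightarrow> M $$ (2 * l, s) = u l + h * i * w l"
      "\<And>l. l < n \<Longrightarrow> M $$ (2 * l + 1, s) = i * u l + h * w l" for s u w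
    unfolding comb_def sum_lessThan_double sum.distrib[symmetric]
    by (intro sum.cong refl coord) (use that in auto)
  have factor: "comb (2 * n) e (\<lambda>r. M $$ (r, 2 * m)) * comb (2 * n) e (\<lambda>r. M $$ (r, 2 * m + 1)) =
      (comb n \<theta> (X m) + comb n \<zeta> (\<lambda>l. - (i * Y m l))) * comb n \<zeta> (Y m)" if m: "m < n" for m
  proof -
    let ?U = "comb n \<theta> (X m)" and ?V = "comb n \<zeta> (Y m)"
    have plus: "?U + \<theta> m * ?H = comb n \<theta> (\<lambda>l. X m l + (if l = m then h else 0))"
      using comb_add_single[OF m] by simp
    have minus: "?U - \<theta> m * ?H = comb n \<theta> (\<lambda>l. X m l + (if l = m then - h else 0))"
      using comb_add_single[OF m, of \<theta> "X m" "- h"] by (simp add: L_minus)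
    have IV: "comb n \<zeta> (\<lambda>l. - (i * Y m l)) = - (?I * ?V)"
      by (simp add: comb_minus comb_scale[OF gen\<zeta>])
    have first: "comb (2 * n) e (\<lambda>r. M $$ (r, 2 * m)) = (?U + \<theta> m * ?H) * ?H - ?I * ?V"
    proof -
      have "comb (2 * n) e (\<lambda>r. M $$ (r, 2 * m)) =
        comb n \<theta> (\<lambda>l. (X m l + (if l = m then h else 0)) * h) + comb n \<zeta> (\<lambda>l. - (i * Y m l))"
      proof (rule column)
        fix l assume l: "l < n"
        have hiiY: "h * i * (- (i * Y m l)) = h * Y m l"
          using ii by (metis mult.assoc mult_minus_left mult_minus_right minus_minus mult_1)
        show "M $$ (2 * l, 2 * m) = (X m l + (if l = m then h else 0)) * h +
            h * i * (- (i * Y m l))"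
          unfolding hiiY M00[OF l m]
          using hhz[of "c m"] h_comm[of "c m"] h_comm[of "x l m"]
          by (simp add: X_def Y_def algebra_simps)
        show "M $$ (2 * l + 1, 2 * m) = i * ((X m l + (if l = m then h else 0)) * h) +
            h * (- (i * Y m l))"
          unfolding M10[OF l m]
          using h_comm[of "x l m"] h_comm[of "c m"]
          by (simp add: X_def Y_def algebra_simps h_i h_i_mult)
      qed
      then show ?thesis by (simp add: plus comb_mult_right IV)
    qed
    have second: "comb (2 * n) e (\<lambda>r. M $$ (r, 2 * m + 1)) = ?V - ?I * ?H * (?U - \<theta> m * ?H)"
    proof -
      have "comb (2 * n) e (\<lambda>r. M $$ (r, 2 * m + 1)) =
        comb n \<theta> (\<lambda>l. - (i * h * (X m l + (if l = m then - h else 0)))) + comb n \<zeta> (Y m)"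
      proof (rule column)
        fix l assume l: "l < n"
        have iihX: "i * (- (i * h * z)) = h * z" for z
          using ii by (metis mult.assoc mult_minus_left mult_minus_right minus_minus mult_1)
        show "M $$ (2 * l, 2 * m + 1) = - (i * h * (X m l + (if l = m then - h else 0))) +
            h * i * Y m l"
          unfolding M01[OF l m] ih
          by (simp add: X_def Y_def algebra_simps)
        show "M $$ (2 * l + 1, 2 * m + 1) =
            i * (- (i * h * (X m l + (if l = m then - h else 0)))) + h * Y m l"
          unfolding M11[OF l m] iihX
          using hhz[of "c m"]
          by (simp add: X_def Y_def algebra_simps)
      qed
      then show ?thesis by (simp add: minus comb_minus comb_scale[OF gen\<theta>, symmetric] L_mult)
    qed
    have comb_commute: "L r * comb n \<epsilon> v = comb n \<epsilon> v * L r"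
      if "generators n \<epsilon>" "central r" for r v \<epsilon>
      by (simp add: comb_scale[OF that(1)] comb_mult_right centralD[OF that(2)])
    have "((?U + \<theta> m * ?H) * ?H - ?I * ?V) * (?V - ?I * ?H * (?U - \<theta> m * ?H)) =
        (?U - ?I * ?V) * ?V"
    proof (rule product_of_block_columns)
      show "anticommuting ?U ?V"
      proof (rule anticommuting_comb[OF gen\<theta> gen\<zeta> ac\<theta>\<zeta>])
        fix k l assume "k < n" "l < n"
        then have "x k m * y l m = y l m * x k m" using m by (intro xy)
        then show "X m k * Y m l = Y m l * X m k"
          using c_comm[of m "y l m"] c_comm[of m "x k m"]
          by (auto simp: X_def Y_def algebra_simps)
      qed
      show "anticommuting (\<theta> m) ?V"
        using gen\<theta> m ac\<theta>\<zeta> by (intro anticommuting_comb_right[OF gen\<zeta>])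
          (auto simp: generators_def)
      show "(?U + \<theta> m * ?H) * (?U - \<theta> m * ?H) = 0"
        unfolding X_def
        using m xx[OF _ _ m] by (intro shifted_column_factorisation[OF gen\<theta> m half]
          h_central c_central) auto
      show "?H * ?U = ?U * ?H" "?I * ?U = ?U * ?I" "?H * ?V = ?V * ?H" "?I * ?V = ?V * ?I"
        by (intro comb_commute gen\<theta> gen\<zeta> h_central i_central)+
      show "?H * \<theta> m = \<theta> m * ?H" "?I * \<theta> m = \<theta> m * ?I"
        using gen\<theta> m by (simp_all add: generators_def)
      show "?I * ?H = ?H * ?I" "?I * ?I = - 1" "?H + ?H = 1"
        by (simp_all add: L_mult[symmetric] L_add[symmetric] ih ii half L_minus L_one)
    qed
    then show ?thesis unfolding first second IV by simp
  qed
  have e_pair: "e (2 * l) * e (2 * l + 1) = \<theta> l * \<zeta> l" if l: "l < n" for l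
  proof -
    let ?x = "e (2 * l)" and ?y = "e (2 * l + 1)"
    have lt: "2 * l < 2 * n" "2 * l + 1 < 2 * n" using l by auto
    have sq: "?x * ?x = 0" "?y * ?y = 0" and ac: "?y * ?x = - (?x * ?y)"
      using gen lt unfolding generators_def exterior_family_def anticommuting_def by blast+
    have "(e j * L p) * (e k * L q) = e j * e k * L (p * q)" if "k < 2 * n" for j k p q
      using gen that unfolding generators_def by (metis L_mult mult.assoc)
    note mult = this[OF lt(1)] this[OF lt(2)]
    have "\<theta> l * \<zeta> l = ?x * ?y * L h - ?x * ?y * L (i * (h * i))"
      unfolding \<theta>_def \<zeta>_def pair_comb_def
      by (simp only: distrib_left distrib_right mult sq ac) simp
    also have "\<dots> = ?x * ?y * L (h + h)"
      by (simp add: ihi L_minus L_add distrib_left)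
    finally show ?thesis by (simp add: half L_one)
  qed
  let ?A = "mat n n (\<lambda>(l, m). x l m + (if l = m then c m else 0))"
  let ?B = "mat n n (\<lambda>(l, m). y l m + (if l = m then c m else 0))"
  let ?U = "\<lambda>m. comb n \<theta> (X m)" and ?V = "\<lambda>m. comb n \<zeta> (Y m)"
  let ?P\<theta> = "prod_list (map \<theta> [0..<n])" and ?P\<zeta> = "prod_list (map \<zeta> [0..<n])"
  have U: "prod_list (map ?U [0..<n]) = ?P\<theta> * L (det_col ?A)"
  proof -
    have "map ?U [0..<n] = map (\<lambda>m. comb n \<theta> (\<lambda>l. ?A $$ (l, m))) [0..<n]"
      by (auto simp: comb_def X_def intro!: sum.cong)
    then show ?thesis using prod_list_comb_eq_det_col[OF gen\<theta>, of ?A] by (simp only: mat_carrier)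
  qed
  have V: "prod_list (map ?V [0..<n]) = ?P\<zeta> * L (det_col ?B)"
  proof -
    have "map ?V [0..<n] = map (\<lambda>m. comb n \<zeta> (\<lambda>l. ?B $$ (l, m))) [0..<n]"
      by (auto simp: comb_def Y_def intro!: sum.cong)
    then show ?thesis using prod_list_comb_eq_det_col[OF gen\<zeta>, of ?B] by (simp only: mat_carrier)
  qed
  have UV: "prod_list (map ?U [0..<n]) * prod_list (map ?V [0..<n]) =
      ?P\<theta> * ?P\<zeta> * L (det_col ?A * det_col ?B)"
  proof -
    have commute: "L r * ?P\<zeta> = ?P\<zeta> * L r" for r
      using generators_prod_list_commute[OF gen\<zeta>, of "[0..<n]"] by (simp add: lessThan_atLeast0)
    have "(?P\<theta> * L r) * (?P\<zeta> * L s) = ?P\<theta> * ?P\<zeta> * L (r * s)" for r s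
    proof -
      have "(?P\<theta> * L r) * (?P\<zeta> * L s) = ?P\<theta> * (L r * ?P\<zeta>) * L s"
        by (simp only: mult.assoc)
      also have "\<dots> = ?P\<theta> * ?P\<zeta> * L (r * s)"
        by (simp only: commute L_mult mult.assoc)
      finally show ?thesis .
    qed
    then show ?thesis unfolding U V .
  qed
  have acU\<zeta>: "anticommuting (?U m) (\<zeta> l)" if "m < n" "l < n" for m l
  proof (rule anticommuting_sym[OF anticommuting_comb_right[OF gen\<theta>]])
    show "anticommuting (\<zeta> l) (\<theta> k)" if "k < n" for k
      by (rule anticommuting_sym[OF ac\<theta>\<zeta>[OF that \<open>l < n\<close>]])
    show "\<zeta> l * L r = L r * \<zeta> l" for r
      using gen\<zeta> \<open>l < n\<close> by (simp add: generators_def)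
  qed
  have acUV: "anticommuting (?U j) (?V k)" if "j < n" "k < n" for j k
  proof (rule anticommuting_comb[OF gen\<theta> gen\<zeta> ac\<theta>\<zeta>])
    fix l l' assume "l < n" "l' < n"
    then have "x l j * y l' k = y l' k * x l j" using that by (intro xy)
    then show "X j l * Y k l' = Y k l' * X j l"
      using c_comm[of j "y l' k"] c_comm[of j "c k"] c_comm[of k "x l j"]
      by (auto simp: X_def Y_def algebra_simps)
  qed
  have e\<theta>\<zeta>: "prod_list (map e [0..<2 * n]) = prod_list (map (\<lambda>m. \<theta> m * \<zeta> m) [0..<n])"
    unfolding prod_list_upt_double using e_pair by (intro arg_cong[of _ _ prod_list] map_cong) auto
  have "prod_list (map e [0..<2 * n]) * L (det_col M) =
      prod_list (map (\<lambda>s. comb (2 * n) e (\<lambda>r. M $$ (r, s))) [0..<2 * n])"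
    by (rule prod_list_comb_eq_det_col[OF gen M, symmetric])
  also have "\<dots> = prod_list (map (\<lambda>m. (?U m + comb n \<zeta> (\<lambda>l. - (i * Y m l))) * ?V m) [0..<n])"
    unfolding prod_list_upt_double using factor
    by (intro arg_cong[of _ _ prod_list] map_cong) auto
  also have "\<dots> = prod_list (map (\<lambda>m. ?U m * ?V m) [0..<n])"
    by (rule prod_list_quadratic_top_degree[OF gen\<zeta> acU\<zeta>])
  also have "\<dots> = prod_list (map (\<lambda>m. \<theta> m * \<zeta> m) [0..<n]) * L (det_col ?A * det_col ?B)"
    using prod_list_shuffle_anticommuting[of n ?U ?V] acUV
      prod_list_shuffle_anticommuting[of n \<theta> \<zeta>] ac\<theta>\<zeta> UV
    by simp
  finally show ?thesis unfolding e\<theta>\<zeta> .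
qed

end

section \<open>A faithful model\<close>

text \<open>
  An element of an exterior algebra is given by its coefficients at the products of generators,
  that is by a function on sets of indices, and the generators act on such functions by left
  multiplication. As operators they live in the ring of additive endomorphisms, so that no
  multiplication of the exterior algebra itself has to be constructed.
\<close>

typedef (overloaded) 'm additive_endo = "{f :: 'm::ab_group_add \<Rightarrow> 'm. \<forall>x y. f (x + y) = f x + f y}"
  morphisms apply_endo Abs_additive_endo
  by (rule exI[of _ id]) simp

setup_lifting type_definition_additive_endo

instantiation additive_endo :: (ab_group_add) "{ring, monoid_mult}"
begin

lift_definition zero_additive_endo :: "'a additive_endo" is "\<lambda>_. 0" by simp
lift_definition one_additive_endo :: "'a additive_endo" is "\<lambda>x. x" by simp
lift_definition plus_additive_endo :: "'a additive_endo \<Rightarrow> 'a additive_endo \<Rightarrow> 'a additive_endo"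
  is "\<lambda>f g x. f x + g x" by (simp add: algebra_simps)
lift_definition uminus_additive_endo :: "'a additive_endo \<Rightarrow> 'a additive_endo"
  is "\<lambda>f x. - f x" by simp
lift_definition minus_additive_endo :: "'a additive_endo \<Rightarrow> 'a additive_endo \<Rightarrow> 'a additive_endo"
  is "\<lambda>f g x. f x - g x" by (simp add: algebra_simps)
lift_definition times_additive_endo :: "'a additive_endo \<Rightarrow> 'a additive_endo \<Rightarrow> 'a additive_endo"
  is "\<lambda>f g x. f (g x)" by simp

instance
  by standard (transfer, simp add: algebra_simps fun_eq_iff)+

end

text \<open>Left multiplication by a coefficient.\<close>

lift_definition left_mult :: "'r::ring \<Rightarrow> (nat set \<Rightarrow> 'r) additive_endo"
  is "\<lambda>r F S. r * F S" by (simp add: fun_eq_iff distrib_left)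

text \<open>
  Left multiplication by the generator with index \<open>k\<close>, where \<open>F S\<close> is the coefficient of \<open>F\<close> at the
  increasing product of the generators with indices in \<open>S\<close>. Infinite \<open>S\<close> are harmless: only the
  finitely many elements of \<open>S\<close> below \<open>k\<close> enter the sign.
\<close>

lift_definition wedge :: "nat \<Rightarrow> (nat set \<Rightarrow> 'r::ring) additive_endo"
  is "\<lambda>k F S. if k \<in> S then
    (if even (card {s \<in> S. s < k}) then F (S - {k}) else - F (S - {k})) else 0"
  by (simp add: fun_eq_iff)

interpretation left_mult:
  coefficient_hom "left_mult :: 'r::{ring,monoid_mult} \<Rightarrow> (nat set \<Rightarrow> 'r) additive_endo"
  by standard (transfer, simp add: fun_eq_iff algebra_simps)+

lemma wedge_anticommute:
  assumes "j < k"
  shows "wedge j * wedge k = - (wedge k * wedge j :: (nat set \<Rightarrow> 'r::ring) additive_endo)"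
  using assms
proof (transfer, intro ext, goal_cases)
  case (1 j k F S)
  have lower: "{s \<in> S. s \<noteq> k \<and> s < j} = {s \<in> S. s < j}" using 1 by auto
  have upper: "even (card {s \<in> S. s \<noteq> j \<and> s < k}) \<longleftrightarrow> odd (card {s \<in> S. s < k})" if "j \<in> S"
  proof -
    have "{s \<in> S. s < k} = insert j {s \<in> S. s \<noteq> j \<and> s < k}" using 1 that by auto
    then show ?thesis by simp
  qed
  have "S - {j} - {k} = S - {k} - {j}" by blast
  then show ?case using 1 by (simp add: lower upper)
qed

lemma wedge_square: "wedge k * wedge k = (0 :: (nat set \<Rightarrow> 'r::ring) additive_endo)"
  by transfer (simp add: fun_eq_iff)

lemma generators_wedge:
  "left_mult.generators n (wedge :: nat \<Rightarrow> (nat set \<Rightarrow> 'r::{ring,monoid_mult}) additive_endo)"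
proof -
  have "anticommuting (wedge i) (wedge j :: (nat set \<Rightarrow> 'r) additive_endo)" for i j
  proof (cases i j rule: linorder_cases)
    case less
    then show ?thesis by (simp add: anticommuting_def wedge_anticommute)
  next
    case equal
    then show ?thesis by (simp add: anticommuting_def wedge_square)
  next
    case greater
    then show ?thesis by (simp add: anticommuting_def wedge_anticommute)
  qed
  moreover have "left_mult r * wedge k = wedge k * left_mult r" for r :: 'r and k
    by transfer (simp add: fun_eq_iff)
  ultimately show ?thesis
    by (simp add: left_mult.generators_def exterior_family_def wedge_square)
qed

text \<open>All signs are trivial, since the least element is removed first.\<close>

lemma apply_endo_prod_wedge:
  assumes "j \<le> n"
  shows "apply_endo (prod_list (map wedge [j..<n])) F {j..<n} = (F {} :: 'r::{ring,monoid_mult})"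
  using assms
proof (induction j rule: inc_induct)
  case base
  show ?case by (simp add: one_additive_endo.rep_eq)
next
  case (step j)
  have sets: "{s. j \<le> s \<and> s < n \<and> s < j} = {}" "{j..<n} - {j} = {Suc j..<n}" by auto
  show ?case
    using step by (simp add: sets upt_conv_Cons times_additive_endo.rep_eq wedge.rep_eq del: upt_Suc)
qed

lemma prod_wedge_cancel:
  fixes r s :: "'r::{ring,monoid_mult}"
  assumes "prod_list (map wedge [0..<n]) * left_mult r = prod_list (map wedge [0..<n]) * left_mult s"
  shows "r = s"
proof -
  have eval:
    "apply_endo (prod_list (map wedge [0..<n]) * left_mult t) (\<lambda>_. 1) {0..<n} = t" for t :: 'r
    by (simp add: times_additive_endo.rep_eq apply_endo_prod_wedge left_mult.rep_eq)
  show ?thesis using eval[of r] unfolding assms eval by (rule sym)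
qed

section \<open>Conjugation and commutation of column-determinants\<close>

lemmas adjoin_i_ops = zero_adjoin_i_def plus_adjoin_i_def uminus_adjoin_i_def minus_adjoin_i_def
  times_adjoin_i_def one_adjoin_i_def

lemma conj_i_1: "conj_i 1 = 1"
  and conj_i_add: "conj_i (x + y) = conj_i x + conj_i y"
  and conj_i_mult: "conj_i (x * y) = conj_i x * conj_i y"
  by (simp_all add: conj_i_def adjoin_i_ops)

interpretation conj_i: coefficient_hom "conj_i :: 'a::{ring,monoid_mult} adjoin_i \<Rightarrow> 'a adjoin_i"
  by standard (simp_all add: conj_i_add conj_i_mult conj_i_1)

lemma (in coefficient_hom) det_col_map_mat: "det_col (map_mat L M) = L (det_col M)"
proof (cases "dim_row M = dim_col M")
  case True
  have "prod_list (map (\<lambda>j. map_mat L M $$ (p j, j)) [0..<dim_col M]) =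
      L (prod_list (map (\<lambda>j. M $$ (p j, j)) [0..<dim_col M]))" if "p permutes {0..<dim_col M}" for p
    unfolding L_prod_list map_map comp_def
    using permutes_in_image[OF that] True by (intro arg_cong[of _ _ prod_list] map_cong) auto
  then show ?thesis
    using True unfolding det_col_def L_sum Let_def
    by (auto simp: L_sum L_minus intro!: sum.cong)
qed (simp add: det_col_def L_0)

lemma commute_det_col:
  fixes x :: "'r::{ring,monoid_mult}"
  assumes M: "M \<in> carrier_mat n n"
    and "\<And>i j. i < n \<Longrightarrow> j < n \<Longrightarrow> x * M $$ (i, j) = M $$ (i, j) * x"
  shows "x * det_col M = det_col M * x"
proof -
  have "x * prod_list (map (\<lambda>j. M $$ (p j, j)) [0..<n]) =
      prod_list (map (\<lambda>j. M $$ (p j, j)) [0..<n]) * x" if "p permutes {0..<n}" for p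
    using permutes_in_image[OF that] assms(2) by (intro commute_prod_list) auto
  then show ?thesis
    using M by (auto simp: det_col_def sum_distrib_left sum_distrib_right Let_def intro!: sum.cong)
qed

section \<open>The realification\<close>

lemma mat_of_blocks2_index:
  assumes "l < n" "m < n"
  shows "mat_of_blocks2 n B $$ (2 * l, 2 * m) = B l m $$ (0, 0)"
    and "mat_of_blocks2 n B $$ (2 * l, Suc (2 * m)) = B l m $$ (0, 1)"
    and "mat_of_blocks2 n B $$ (Suc (2 * l), 2 * m) = B l m $$ (1, 0)"
    and "mat_of_blocks2 n B $$ (Suc (2 * l), Suc (2 * m)) = B l m $$ (1, 1)"
  using assms by (simp_all add: mat_of_blocks2_def)

lemma realification_carrier:
  "E \<in> carrier_mat n n \<Longrightarrow> realification E \<in> carrier_mat (2 * n) (2 * n)"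
  by (simp add: realification_def mat_of_blocks2_def)

lemma realification_index:
  assumes "E \<in> carrier_mat n n" "l < n" "m < n"
  shows "realification E $$ (2 * l, 2 * m) = re_part (E $$ (l, m))"
    and "realification E $$ (2 * l, Suc (2 * m)) = im_part (E $$ (l, m))"
    and "realification E $$ (Suc (2 * l), 2 * m) = - im_part (E $$ (l, m))"
    and "realification E $$ (Suc (2 * l), Suc (2 * m)) = re_part (E $$ (l, m))"
  using assms by (simp_all add: realification_def mat_of_blocks2_index mat_of_rows_list_def)

lemma T_mat_carrier: "(T_mat n :: 'k::field adjoin_i mat) \<in> carrier_mat (2 * n) (2 * n)"
  by (simp add: T_mat_def mat_of_blocks2_def)

lemma T_mat_index:
  assumes "l < n" "m < n"
  shows "T_mat n $$ (2 * l, 2 * m) =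
      (if l = m then Adj (of_nat (n - Suc m) + 1 / 4) 0 else 0)"
    and "T_mat n $$ (2 * l, Suc (2 * m)) = (if l = m then Adj 0 (1 / 4) else 0)"
    and "T_mat n $$ (Suc (2 * l), 2 * m) = (if l = m then Adj 0 (1 / 4) else 0)"
    and "T_mat n $$ (Suc (2 * l), Suc (2 * m)) =
      (if l = m then Adj (of_nat (n - Suc m) - 1 / 4) 0 else 0)"
  using assms by (simp_all add: T_mat_def mat_of_blocks2_index mat_of_rows_list_def)

text \<open>The identity for \<open>T\<close> itself.\<close>

lemma det_col_realification_T:
  fixes scale :: "'k::field \<Rightarrow> 'a::{ring,monoid_mult} \<Rightarrow> 'a"
    and n :: nat
    and E :: "'a adjoin_i mat"
  assumes char: "CHAR('k) \<noteq> 2"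
    and alg: "unital_algebra scale"
    and dim: "E \<in> carrier_mat n n"
    and comm: "\<And>i j k l. i < n \<Longrightarrow> j < n \<Longrightarrow> k < n \<Longrightarrow> l < n \<Longrightarrow>
      commutator (E $$ (i, j)) (E $$ (k, l)) =
        (if j = k then E $$ (i, l) else 0) - (if l = i then E $$ (k, j) else 0)"
    and comm_conj: "\<And>i j k l. i < n \<Longrightarrow> j < n \<Longrightarrow> k < n \<Longrightarrow> l < n \<Longrightarrow>
      commutator (E $$ (i, j)) (conj_i (E $$ (k, l))) = 0"
  shows "det_col (map_mat of_base (realification E) + map_mat (scalar_i scale) (T_mat n)) =
      det_col (E + map_mat (scalar_i scale) (shift_diag n)) *
      det_col (map_mat conj_i E + map_mat (scalar_i scale) (shift_diag n))"
proof -
  interpret unital_algebra scale by (rule alg)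
  have "(2::'k) \<noteq> 0"
  proof
    assume "(2::'k) = 0"
    then have "of_nat 2 = (0::'k)" by simp
    then have "CHAR('k) dvd 2" by (simp only: of_nat_eq_0_iff_char_dvd)
    then have "CHAR('k) \<le> 2" "CHAR('k) \<noteq> 0"
      using dvd_imp_le[of "CHAR('k)" 2] by (simp, metis dvd_0_left_iff zero_neq_numeral)
    moreover have "CHAR('k) \<noteq> 1"
      using of_nat_CHAR[where 'a = 'k] by (metis of_nat_1 zero_neq_one)
    ultimately show False using char by linarith
  qed
  then have half: "1 / 2 + 1 / 2 = (1::'k)" and quarter: "1 / 2 * (1 / 2) = (1 / 4::'k)"
    by (simp_all add: field_simps)
  have scale_one_mult: "scale a 1 * x = scale a x" "x * scale a 1 = scale a x" for a x
    by (simp_all add: scale_mult_left scale_mult_right)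
  define i where "i = (Adj 0 1 :: 'a adjoin_i)"
  define h where "h = (of_base (scale (1 / 2) 1) :: 'a adjoin_i)"
  define c where "c = (\<lambda>m. of_base (scale (of_nat (n - Suc m)) 1) :: 'a adjoin_i)"
  have halves: "scale (1 / 2) x + scale (1 / 2) x = x" for x
    by (simp flip: scale_left_distrib add: half)
  have re: "h * (z + conj_i z) = of_base (re_part z)" for z
    by (simp add: h_def of_base_def conj_i_def adjoin_i_ops scale_one_mult scale_right_distrib halves)
  have im: "i * h * (z - conj_i z) = - of_base (im_part z)" for z
    by (simp add: i_def h_def of_base_def conj_i_def adjoin_i_ops scale_one_mult
        scale_right_distrib halves)
  have hh: "h * h = of_base (scale (1 / 4) 1)"
    by (simp add: h_def of_base_def adjoin_i_ops scale_one_mult quarter)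
  have ihh: "i * h * h = Adj 0 (scale (1 / 4) 1)"
    by (simp add: i_def h_def of_base_def adjoin_i_ops scale_one_mult quarter)
  let ?M = "map_mat of_base (realification E) + map_mat (scalar_i scale) (T_mat n)"
  let ?A = "mat n n (\<lambda>(l, m). E $$ (l, m) + (if l = m then c m else 0))"
  let ?B = "mat n n (\<lambda>(l, m). conj_i (E $$ (l, m)) + (if l = m then c m else 0))"
  note carriers = realification_carrier[OF dim] T_mat_carrier[where 'k = 'k and n = n]
  have M: "?M $$ (r, s) =
      of_base (realification E $$ (r, s)) + scalar_i scale (T_mat n $$ (r, s))"
    if "r < 2 * n" "s < 2 * n" for r s
    using that carriers[THEN carrier_matD(1)] carriers[THEN carrier_matD(2)] by simp
  have entries: "?M $$ (2 * l, 2 * m) =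
      of_base (re_part (E $$ (l, m))) + (if l = m then c m + h * h else 0)"
    "?M $$ (2 * l + 1, 2 * m) =
      - of_base (im_part (E $$ (l, m))) + (if l = m then i * h * h else 0)"
    "?M $$ (2 * l, 2 * m + 1) =
      of_base (im_part (E $$ (l, m))) + (if l = m then i * h * h else 0)"
    "?M $$ (2 * l + 1, 2 * m + 1) =
      of_base (re_part (E $$ (l, m))) + (if l = m then c m - h * h else 0)"
    if "l < n" "m < n" for l m
    using that unfolding hh ihh
    by (simp_all add: M realification_index[OF dim] T_mat_index c_def of_base_def
        scalar_i_def adjoin_i_ops scale_left_distrib scale_left_diff_distrib)
  have "det_col ?M = det_col ?A * det_col ?B"
  proof (rule prod_wedge_cancel, rule left_mult.det_col_blocks[where i = i and h = h])
    show "left_mult.generators (2 * n) wedge" by (rule generators_wedge)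
    show "central i" "central h" "central (c m)" for m
      by (simp_all add: central_def i_def h_def c_def of_base_def adjoin_i_ops scale_one_mult)
    show "?M \<in> carrier_mat (2 * n) (2 * n)"
      using carriers by simp
    show "i * i = - 1" by (simp add: i_def adjoin_i_ops)
    show "h + h = 1" by (simp add: h_def of_base_def adjoin_i_ops halves)
    show "E $$ (l, m) * E $$ (l', m) - E $$ (l', m) * E $$ (l, m) =
        (if l' = m then E $$ (l, m) else 0) - (if l = m then E $$ (l', m) else 0)"
      if "l < n" "l' < n" "m < n" for l l' m
      using comm[of l m l' m] that by (auto simp: commutator_def)
    show "E $$ (j, k) * conj_i (E $$ (l, m)) = conj_i (E $$ (l, m)) * E $$ (j, k)"
      if "j < n" "k < n" "l < n" "m < n" for j k l m
      using comm_conj[OF that] by (simp add: commutator_def)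
  qed (simp_all only: entries re im minus_minus)
  moreover have "E + map_mat (scalar_i scale) (shift_diag n) = ?A"
    using dim by (intro eq_matI)
      (auto simp: shift_diag_def mat_diag_def c_def of_base_def scalar_i_def adjoin_i_ops)
  moreover have "map_mat conj_i E + map_mat (scalar_i scale) (shift_diag n) = ?B"
    using dim by (intro eq_matI)
      (auto simp: shift_diag_def mat_diag_def c_def of_base_def scalar_i_def adjoin_i_ops)
  ultimately show ?thesis by simp
qed

theorem theorem3:
  fixes scale :: "'k::field \<Rightarrow> 'a::{ring,monoid_mult} \<Rightarrow> 'a"
    and n :: nat
    and E :: "'a adjoin_i mat"
  assumes char: "CHAR('k) \<noteq> 2"
    and alg: "unital_algebra scale"
    and dim: "E \<in> carrier_mat n n"
    and comm: "\<And>i j k l. i < n \<Longrightarrow> j < n \<Longrightarrow> k < n \<Longrightarrow> l < n \<Longrightarrow>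
      commutator (E $$ (i, j)) (E $$ (k, l)) =
        (if j = k then E $$ (i, l) else 0) - (if l = i then E $$ (k, j) else 0)"
    and comm_conj: "\<And>i j k l. i < n \<Longrightarrow> j < n \<Longrightarrow> k < n \<Longrightarrow> l < n \<Longrightarrow>
      commutator (E $$ (i, j)) (conj_i (E $$ (k, l))) = 0"
  shows "det_col (map_mat of_base (realification E) + map_mat (scalar_i scale) (T_mat n)) =
      det_col (E + map_mat (scalar_i scale) (shift_diag n)) *
      det_col (map_mat conj_i E + map_mat (scalar_i scale) (shift_diag n)) \<and>
      det_col (map_mat of_base (realification E) +
        map_mat (scalar_i scale) (map_mat conj_i (T_mat n))) =
      det_col (E + map_mat (scalar_i scale) (shift_diag n)) *
      det_col (map_mat conj_i E + map_mat (scalar_i scale) (shift_diag n))"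
proof -
  interpret unital_algebra scale by (rule alg)
  let ?S = "map_mat (scalar_i scale) (shift_diag n)"
  let ?M = "map_mat of_base (realification E) + map_mat (scalar_i scale) (T_mat n)"
  let ?M' = "map_mat of_base (realification E) +
    map_mat (scalar_i scale) (map_mat conj_i (T_mat n))"
  have first: "det_col ?M = det_col (E + ?S) * det_col (map_mat conj_i E + ?S)"
    by (rule det_col_realification_T[OF char alg dim comm comm_conj])
  have scalar_conj: "scalar_i scale (conj_i z) = conj_i (scalar_i scale z)" for z
    by (simp add: scalar_i_def conj_i_def)
  have S: "?S $$ (l, m) = (if l = m then of_base (scale (of_nat (n - Suc m)) 1) else 0)"
    if "l < n" "m < n" for l m
    using that by (simp add: shift_diag_def mat_diag_def of_base_def scalar_i_def adjoin_i_ops)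
  have S_carrier: "?S \<in> carrier_mat n n" by (simp add: shift_diag_def)
  have M': "?M' = map_mat conj_i ?M"
    using dim by (intro eq_matI)
      (auto simp: realification_def T_mat_def mat_of_blocks2_def scalar_conj conj_i_add,
       auto simp: of_base_def conj_i_def)
  have conj_S: "map_mat conj_i (E + ?S) = map_mat conj_i E + ?S"
    "map_mat conj_i (map_mat conj_i E + ?S) = E + ?S"
    using dim by (auto simp: shift_diag_def mat_diag_def of_base_def scalar_i_def
        conj_i_def adjoin_i_ops)
  have commute: "det_col (map_mat conj_i E + ?S) * det_col (E + ?S) =
      det_col (E + ?S) * det_col (map_mat conj_i E + ?S)"
  proof -
    have central_S: "?S $$ (l, m) * z = z * ?S $$ (l, m)" if "l < n" "m < n" for l m z
      using S[OF that] by (simp add: of_base_def adjoin_i_ops scale_mult_left scale_mult_right)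
    have "(E + ?S) $$ (i, j) * (map_mat conj_i E + ?S) $$ (k, l) =
        (map_mat conj_i E + ?S) $$ (k, l) * (E + ?S) $$ (i, j)"
      if "i < n" "j < n" "k < n" "l < n" for i j k l
    proof -
      have "E $$ (i, j) * conj_i (E $$ (k, l)) = conj_i (E $$ (k, l)) * E $$ (i, j)"
        using comm_conj[OF that] by (simp add: commutator_def)
      then show ?thesis
        using that dim S_carrier central_S[of i j "conj_i (E $$ (k, l)) + ?S $$ (k, l)"]
          central_S[of k l "E $$ (i, j)"]
        by (simp add: distrib_left distrib_right)
    qed
    then have "(E + ?S) $$ (i, j) * det_col (map_mat conj_i E + ?S) =
        det_col (map_mat conj_i E + ?S) * (E + ?S) $$ (i, j)" if "i < n" "j < n" for i j
      using that S_carrier by (intro commute_det_col[of _ n]) auto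
    then show ?thesis
      using S_carrier by (intro commute_det_col[of _ n]) auto
  qed
  have "det_col ?M' = conj_i (det_col ?M)"
    unfolding M' by (rule conj_i.det_col_map_mat)
  also have "\<dots> = conj_i (det_col (E + ?S)) * conj_i (det_col (map_mat conj_i E + ?S))"
    by (simp add: first conj_i_mult)
  also have "\<dots> = det_col (map_mat conj_i E + ?S) * det_col (E + ?S)"
    by (simp only: conj_i.det_col_map_mat[symmetric] conj_S)
  finally show ?thesis using first commute by simp
qed

end
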